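(* $R_{C_3}(4,4,4)=R(3,3,3)+1$; that is, $R_{C_3}(4,4,4)=18$.
   Context: $C_3\le S_3$ denotes the cyclic group generated by $(1\,2\,3)$. A $3$-edge-coloured complete graph is a complete graph with each edge coloured from $\{1,2,3\}$. For $\pi\in C_3$ and a vertex $v$, switching at $v$ with $\pi$ recolours every edge incident with $v$ of colour $i$ to colour $\pi(i)$, leaving other edges unchanged. Two such graphs on the same vertex set are $C_3$-switch equivalent if one is obtained from the other by a finite sequence of switches. $K_t^{(i)}$ is a complete graph on $t$ vertices with all edges of colour $i$. $R_{C_3}(a_1,a_2,a_3)$ is the least $n$ such that every $3$-edge-coloured complete graph on $n$ vertices is $C_3$-switch equivalent to one containing, for some $i$, a copy of $K_{a_i}^{(i)}$. $R(3,3,3)=17$ is the classical $3$-colour Ramsey number. *)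

theory Defs
  imports "HOL-Algebra.Sym_Groups" "HOL-Library.Ramsey"
begin

definition C3 :: "(nat \<Rightarrow> nat) set" where
  "C3 = generate (sym_group 3) {cycle_of_list [1, 2, 3]}"

text \<open>A colouring is a function on the 2-subsets of the vertex set; it is kept extensional
  (\<^term>\<open>undefined\<close> off the edges) so that equality of functions is equality of
  edge-coloured graphs.\<close>

definition edge_colourings :: "'v set \<Rightarrow> ('v set \<Rightarrow> nat) set" where
  "edge_colourings V = ([V]\<^bsup>2\<^esup> \<rightarrow>\<^sub>E {1..3})"

definition switch ::
  "'v set \<Rightarrow> 'v \<Rightarrow> (nat \<Rightarrow> nat) \<Rightarrow> ('v set \<Rightarrow> nat) \<Rightarrow> ('v set \<Rightarrow> nat)" where
  "switch V v \<pi> c = (\<lambda>e. if e \<in> [V]\<^bsup>2\<^esup> \<and> v \<in> e then \<pi> (c e) else c e)"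

inductive C3_switch_equiv ::
  "'v set \<Rightarrow> ('v set \<Rightarrow> nat) \<Rightarrow> ('v set \<Rightarrow> nat) \<Rightarrow> bool"
  for V :: "'v set" and c :: "'v set \<Rightarrow> nat" where
  refl: "C3_switch_equiv V c c"
| step: "\<lbrakk>C3_switch_equiv V c c'; v \<in> V; \<pi> \<in> C3\<rbrakk>
    \<Longrightarrow> C3_switch_equiv V c (switch V v \<pi> c')"

text \<open>\<^term>\<open>monochromatic V a 2 c i\<close> says that the colouring \<^term>\<open>c\<close> of the complete graph
  on \<^term>\<open>V\<close> contains a complete graph on \<^term>\<open>a\<close> vertices with all edges of colour
  \<^term>\<open>i\<close>.\<close>

definition C3_ramsey_number :: "nat \<Rightarrow> nat \<Rightarrow> nat \<Rightarrow> nat" where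
  "C3_ramsey_number a1 a2 a3 =
     (LEAST n. \<forall>c \<in> edge_colourings {..<n}. \<exists>c'. C3_switch_equiv {..<n} c c' \<and>
        (monochromatic {..<n} a1 2 c' 1 \<or>
         monochromatic {..<n} a2 2 c' 2 \<or>
         monochromatic {..<n} a3 2 c' 3))"

definition ramsey_number :: "nat \<Rightarrow> nat \<Rightarrow> nat \<Rightarrow> nat" where
  "ramsey_number a1 a2 a3 =
     (LEAST n. \<forall>c \<in> edge_colourings {..<n}.
         monochromatic {..<n} a1 2 c 1 \<or>
         monochromatic {..<n} a2 2 c 2 \<or>
         monochromatic {..<n} a3 2 c 3)"

end

theory Submission
  imports Defs "HOL-Number_Theory.Cong"
begin

text \<open>Upper bounds: switching the vertices other than \<open>v\<close> makes all edges at \<open>v\<close> have one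
  colour, and a switch at \<open>v\<close> then matches it to a monochromatic triangle among the others,
  so the \<open>C\<^sub>3\<close>-number is at most \<open>R(3,3,3) + 1\<close>; and \<open>R(3,3,3) \<le> 17\<close> by pigeonhole on the edges at
  a vertex.

  Lower bounds: modulo 3, a sequence of switches adds \<open>f a + f b\<close> to the colour of each edge
  \<open>ab\<close>, so four vertices can become monochromatic only if their three perfect matchings have
  the same colour sum. On 17 vertices a circulant colouring avoids this. Hence the \<open>C\<^sub>3\<close>-number
  exceeds 17, which by the upper bound forces \<open>R(3,3,3) \<ge> 17\<close> as well.\<close>

section \<open>Switching as addition modulo 3\<close>

text \<open>The 3-cycle is translation by 1 on residues, with 3 in the role of 0; its inverse
  translates by 2, and composition adds shifts.\<close>

lemma C3_shift:
  assumes "\<pi> \<in> C3"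
  shows "\<exists>k::nat. \<forall>i\<in>{1..3}. \<pi> i \<in> {1..3} \<and> [\<pi> i = i + k] (mod 3)"
proof -
  define \<sigma> :: "nat \<Rightarrow> nat" where "\<sigma> = cycle_of_list [1, 2, 3]"
  have \<sigma>: "\<sigma> permutes {1..3}" "\<sigma> 1 = 2" "\<sigma> 2 = 3" "\<sigma> 3 = 1"
  proof -
    have "set [1,2,3::nat] = {1..3}"
      by auto
    then show "\<sigma> permutes {1..3}"
      unfolding \<sigma>_def by (metis cycle_permutes)
  qed (auto simp: \<sigma>_def transpose_def)
  have inv_group: "inv\<^bsub>sym_group 3\<^esub> \<sigma> = inv' \<sigma>"
    using \<sigma> by (simp add: sym_group_carrier)
  have inv\<sigma>: "inv' \<sigma> 1 = 3" "inv' \<sigma> 2 = 1" "inv' \<sigma> 3 = 2"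
    using \<sigma> by (auto simp: permutes_inv_eq)
  have three: "{1..3} = {1, 2, 3::nat}"
    by auto
  from assms have "\<pi> \<in> generate (sym_group 3) {\<sigma>}"
    by (simp add: C3_def \<sigma>_def)
  then show ?thesis
  proof induction
    case one
    show ?case
      by (intro exI[of _ 0]) (auto simp: sym_group_one)
  next
    case (incl h)
    then show ?case
      using \<sigma> unfolding three by (intro exI[of _ 1]) (simp add: cong_def)
  next
    case (inv h)
    then show ?case
      using inv\<sigma> inv_group unfolding three by (intro exI[of _ 2]) (simp add: cong_def)
  next
    case (eng h1 h2)
    then obtain k1 k2 where
      h1: "\<And>i. i \<in> {1..3} \<Longrightarrow> h1 i \<in> {1..3} \<and> [h1 i = i + k1] (mod 3)" and
      h2: "\<And>i. i \<in> {1..3} \<Longrightarrow> h2 i \<in> {1..3} \<and> [h2 i = i + k2] (mod 3)"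
      by blast
    have "[h1 (h2 i) = i + (k2 + k1)] (mod 3)" if "i \<in> {1..3}" for i
      using h1[of "h2 i"] h2[OF that] cong_trans[OF _ cong_add[OF _ cong_refl]]
      by (metis add.assoc)
    with h1 h2 show ?case
      by (intro exI[of _ "k2 + k1"]) (auto simp: sym_group_mult)
  qed
qed

text \<open>The identity, the 3-cycle and its square suffice. Hence one switch at an endpoint gives
  an edge any prescribed colour.\<close>

lemma C3_transitive:
  assumes "i \<in> {1..3}" "j \<in> {1..3}"
  obtains \<pi> where "\<pi> \<in> C3" "\<pi> i = j"
proof -
  define \<sigma> :: "nat \<Rightarrow> nat" where "\<sigma> = cycle_of_list [1, 2, 3]"
  have \<sigma>: "\<sigma> 1 = 2" "\<sigma> 2 = 3" "\<sigma> 3 = 1"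
    by (auto simp: \<sigma>_def transpose_def)
  have C: "id \<in> C3" "\<sigma> \<in> C3" "\<sigma> \<circ> \<sigma> \<in> C3"
    using generate.one[of "sym_group 3" "{\<sigma>}"] generate.incl[of \<sigma> "{\<sigma>}" "sym_group 3"]
      generate.eng[of \<sigma> "sym_group 3" "{\<sigma>}" \<sigma>]
    by (auto simp: C3_def \<sigma>_def sym_group_one sym_group_mult)
  from assms consider "i = j" | "\<sigma> i = j" | "\<sigma> (\<sigma> i) = j"
    using \<sigma> by (simp add: atLeastAtMost_iff) (metis One_nat_def Suc_1 le_SucE le_antisym numeral_3_eq_3)
  then show ?thesis
    by cases (use that C in \<open>fastforce+\<close>)
qed

lemma switch_in_edge_colourings:
  assumes "c \<in> edge_colourings V" "\<pi> \<in> C3"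
  shows "switch V v \<pi> c \<in> edge_colourings V"
  using C3_shift[OF assms(2)] assms(1)
  by (auto simp: edge_colourings_def switch_def PiE_iff extensional_def)

lemma C3_switch_equiv_in_edge_colourings:
  assumes "C3_switch_equiv V c c'" "c \<in> edge_colourings V"
  shows "c' \<in> edge_colourings V"
  using assms by induction (auto intro: switch_in_edge_colourings)

text \<open>\<open>f v\<close> accumulates the shifts applied at \<open>v\<close>; shifts commute,
  so only these totals matter.\<close>

lemma C3_switch_equiv_potential:
  assumes "C3_switch_equiv V c c'" "c \<in> edge_colourings V"
  obtains f :: "_ \<Rightarrow> nat" where
    "\<And>a b. a \<in> V \<Longrightarrow> b \<in> V \<Longrightarrow> a \<noteq> b \<Longrightarrow> [c' {a, b} = c {a, b} + (f a + f b)] (mod 3)"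
proof -
  have "\<exists>f::_ \<Rightarrow> nat. \<forall>a\<in>V. \<forall>b\<in>V. a \<noteq> b \<longrightarrow> [c' {a, b} = c {a, b} + (f a + f b)] (mod 3)"
    using assms(1)
  proof induction
    case refl
    show ?case
      by (intro exI[of _ "\<lambda>_. 0"]) auto
  next
    case (step c' v \<pi>)
    then obtain f where
      f: "\<And>a b. a \<in> V \<Longrightarrow> b \<in> V \<Longrightarrow> a \<noteq> b \<Longrightarrow> [c' {a, b} = c {a, b} + (f a + f b)] (mod 3)"
      by blast
    obtain k where k: "\<And>i. i \<in> {1..3} \<Longrightarrow> [\<pi> i = i + k] (mod 3)"
      using C3_shift[OF step.hyps(3)] by blast
    have c': "c' \<in> edge_colourings V"
      using C3_switch_equiv_in_edge_colourings step.hyps(1) assms(2) .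
    \<comment> \<open>Since \<open>a\<close> and \<open>b\<close> differ, a switch at
      \<open>v\<close> raises at most one of the two potentials, so \<open>k\<close> is never
      counted twice.\<close>
    have "[switch V v \<pi> c' {a, b} = c {a, b} + ((f(v := f v + k)) a + (f(v := f v + k)) b)] (mod 3)"
      if ab: "a \<in> V" "b \<in> V" "a \<noteq> b" for a b
    proof (cases "v \<in> {a, b}")
      case True
      have "{a, b} \<in> [V]\<^bsup>2\<^esup>"
        using ab by simp
      then have "c' {a, b} \<in> {1..3}"
        using c' unfolding edge_colourings_def by (rule PiE_mem[rotated])
      then have "[\<pi> (c' {a, b}) = c {a, b} + (f a + f b) + k] (mod 3)"
        using k f[OF ab] by (meson cong_add cong_refl cong_trans)
      with True ab show ?thesis
        by (auto simp: switch_def ac_simps)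
    next
      case False
      with f[OF ab] show ?thesis
        by (auto simp: switch_def)
    qed
    then show ?case
      by blast
  qed
  with that show ?thesis
    by blast
qed

text \<open>A perfect matching meets each of the four vertices once, so every matching sum gains the
  same \<open>f a + f b + f u + f v\<close>, which cancels.\<close>

lemma mono_K4_balanced:
  assumes equiv: "C3_switch_equiv V c c'" "c \<in> edge_colourings V"
    and mono: "a \<in> V" "b \<in> V" "u \<in> V" "v \<in> V" "distinct [a, b, u, v]" "c' ` [{a, b, u, v}]\<^bsup>2\<^esup> \<subseteq> {i}"
  shows "[c {a, b} + c {u, v} = c {a, u} + c {b, v}] (mod 3)"
proof -
  obtain f :: "_ \<Rightarrow> nat" where f:
    "\<And>a b. a \<in> V \<Longrightarrow> b \<in> V \<Longrightarrow> a \<noteq> b \<Longrightarrow> [c' {a, b} = c {a, b} + (f a + f b)] (mod 3)"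
    using C3_switch_equiv_potential[OF equiv] by blast
  have c': "c' {x, y} = i" if "x \<in> {a, b, u, v}" "y \<in> {a, b, u, v}" "x \<noteq> y" for x y
    using mono(6) doubleton_in_nsets_2[of x y "{a, b, u, v}"] that by blast
  have "[c {a, b} + c {u, v} + (f a + f b + f u + f v) = c' {a, b} + c' {u, v}] (mod 3)"
    using cong_add[OF f[of a b] f[of u v]] mono by (auto simp: cong_sym_eq ac_simps)
  also have "c' {a, b} + c' {u, v} = c' {a, u} + c' {b, v}"
    using c' mono(5) by simp
  also have "[c' {a, u} + c' {b, v} = c {a, u} + c {b, v} + (f a + f b + f u + f v)] (mod 3)"
    using cong_add[OF f[of a u] f[of b v]] mono by (auto simp: cong_sym_eq ac_simps)
  finally show ?thesis
    by (simp add: cong_add_rcancel_nat)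
qed

section \<open>Monochromatic triangles by pigeonhole\<close>

definition has_mono :: "nat \<Rightarrow> nat \<Rightarrow> (nat set \<Rightarrow> nat) \<Rightarrow> bool" where
  "has_mono n t c \<longleftrightarrow> (\<exists>i\<in>{1..3}. monochromatic {..<n} t 2 c i)"

lemma has_mono_iff:
  "has_mono n t c \<longleftrightarrow> monochromatic {..<n} t 2 c 1 \<or>
     monochromatic {..<n} t 2 c 2 \<or> monochromatic {..<n} t 2 c 3"
proof -
  have "{1..3} = {1, 2, 3::nat}"
    by auto
  then show ?thesis
    by (simp add: has_mono_def)
qed

text \<open>The values are 2, 3, 6, 17. With no colours two vertices suffice, as their edge cannot
  be coloured.\<close>

fun triangle_bound :: "nat \<Rightarrow> nat" where
  "triangle_bound 0 = 2"
| "triangle_bound (Suc k) = Suc k * (triangle_bound k - 1) + 2"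

text \<open>Induction on the number of colours; the palette \<open>I\<close> is arbitrary because
  the step deletes whichever colour is frequent at \<open>v\<close>.\<close>

lemma mono_triangle:
  assumes "finite I" "finite V" "triangle_bound (card I) \<le> card V" "c \<in> [V]\<^bsup>2\<^esup> \<rightarrow> I"
  shows "\<exists>i\<in>I. monochromatic V 3 2 c i"
  using assms
proof (induction "card I" arbitrary: I V)
  case 0
  then have "card V \<ge> 2" "I = {}"
    by auto
  then have "[V]\<^bsup>2\<^esup> \<noteq> {}"
    using 0 by (simp add: nsets_eq_empty_iff)
  with 0 \<open>I = {}\<close> show ?case
    by auto
next
  case (Suc k)
  have bound: "Suc k * (triangle_bound k - 1) + 2 \<le> card V"
    using Suc.prems(3) by (simp flip: Suc.hyps(2))
  then obtain v where "v \<in> V"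
    by fastforce
  define N where "N i = {x \<in> V - {v}. c {v, x} = i}" for i
  \<comment> \<open>Otherwise the classes \<open>N i\<close> hold at most
    \<open>Suc k * (triangle_bound k - 1)\<close> vertices, too few to cover
    \<open>V - {v}\<close>.\<close>
  have "\<exists>i\<in>I. triangle_bound k \<le> card (N i)"
  proof (rule ccontr)
    assume "\<not> ?thesis"
    then have small: "card (N i) \<le> triangle_bound k - 1" if "i \<in> I" for i
      using that by fastforce
    have "V - {v} \<subseteq> (\<Union>i\<in>I. N i)"
      using Suc.prems(4) \<open>v \<in> V\<close> by (auto simp: N_def)
    then have "card (V - {v}) \<le> card (\<Union>i\<in>I. N i)"
      using Suc.prems by (intro card_mono) (auto simp: N_def)
    also have "\<dots> \<le> (\<Sum>i\<in>I. card (N i))"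
      using Suc.prems by (intro card_UN_le)
    also have "\<dots> \<le> card I * (triangle_bound k - 1)"
      using sum_bounded_above[OF small] by simp
    finally have "card V - 1 \<le> Suc k * (triangle_bound k - 1)"
      using \<open>v \<in> V\<close> Suc.prems Suc.hyps(2) by simp
    with bound show False
      by linarith
  qed
  then obtain i where i: "i \<in> I" "triangle_bound k \<le> card (N i)"
    by blast
  have "N i \<subseteq> V" "finite (N i)"
    using Suc.prems by (auto simp: N_def)
  \<comment> \<open>An edge of colour \<open>i\<close> inside \<open>N i\<close> closes a triangle
    with \<open>v\<close>; without one, \<open>N i\<close> uses one colour fewer.\<close>
  show ?case
  proof (cases "\<exists>x\<in>N i. \<exists>y\<in>N i. x \<noteq> y \<and> c {x, y} = i")
    case True
    then obtain x y where xy: "x \<in> N i" "y \<in> N i" "x \<noteq> y" "c {x, y} = i"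
      by blast
    then have "{v, x, y} \<in> [V]\<^bsup>3\<^esup>"
      using \<open>v \<in> V\<close> by (auto simp: nsets_def N_def)
    moreover have "c ` [{v, x, y}]\<^bsup>2\<^esup> \<subseteq> {i}"
      using xy by (auto simp: N_def elim!: nsets2_E simp: insert_commute)
    ultimately show ?thesis
      using i(1) by (auto simp: monochromatic_def)
  next
    case False
    have "c \<in> [N i]\<^bsup>2\<^esup> \<rightarrow> I - {i}"
    proof
      fix e
      assume e: "e \<in> [N i]\<^bsup>2\<^esup>"
      then have "c e \<in> I"
        using Suc.prems(4) nsets_mono[OF \<open>N i \<subseteq> V\<close>] by blast
      with e False show "c e \<in> I - {i}"
        by (auto elim!: nsets2_E)
    qed
    moreover have "card (I - {i}) = k"
      using Suc.hyps(2) Suc.prems(1) i(1) by simp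
    ultimately obtain j where "j \<in> I - {i}" "monochromatic (N i) 3 2 c j"
      using Suc.hyps(1)[of "I - {i}" "N i"] Suc.prems(1) \<open>finite (N i)\<close> i(2) by auto
    then show ?thesis
      using nsets_mono[OF \<open>N i \<subseteq> V\<close>, of 3] by (auto simp: monochromatic_def)
  qed
qed

lemma has_mono_triangle_17:
  assumes "c \<in> edge_colourings {..<17}"
  shows "has_mono 17 3 c"
proof -
  have "triangle_bound (card {1..3::nat}) = 17"
    by (simp add: numeral_3_eq_3)
  with assms show ?thesis
    unfolding has_mono_def edge_colourings_def
    by (intro mono_triangle) auto
qed

section \<open>Upper bound by normalising a star\<close>

text \<open>A switch at \<open>x\<close> changes only one edge of the star at \<open>v\<close>, so
  the edges can be corrected one after another.\<close>

lemma C3_switch_equiv_colour_star: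
  assumes c: "c \<in> edge_colourings V" and v: "v \<in> V" and "finite S" "S \<subseteq> V - {v}" and j: "j \<in> {1..3}"
  shows "\<exists>c'. C3_switch_equiv V c c' \<and> (\<forall>u\<in>S. c' {u, v} = j)"
  using assms(3,4)
proof induction
  case empty
  show ?case
    by (auto intro: C3_switch_equiv.refl)
next
  case (insert x S)
  then obtain c' where c': "C3_switch_equiv V c c'" "\<forall>u\<in>S. c' {u, v} = j"
    by auto
  have xv: "{x, v} \<in> [V]\<^bsup>2\<^esup>"
    using insert.prems v by auto
  have "c' {x, v} \<in> {1..3}"
    using C3_switch_equiv_in_edge_colourings[OF c'(1) c] xv
    unfolding edge_colourings_def by (rule PiE_mem)
  then obtain \<pi> where \<pi>: "\<pi> \<in> C3" "\<pi> (c' {x, v}) = j"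
    using C3_transitive j by blast
  have "C3_switch_equiv V c (switch V x \<pi> c')"
    using c'(1) \<pi>(1) insert.prems by (auto intro: C3_switch_equiv.step)
  moreover have "switch V x \<pi> c' {u, v} = j" if "u \<in> insert x S" for u
    using that c'(2) \<pi>(2) xv insert.hyps insert.prems by (auto simp: switch_def)
  ultimately show ?case
    by blast
qed

text \<open>General \<open>n\<close> matters: the contrapositive carries the lower bound back to the
  classical number.\<close>

lemma has_mono_switch_Suc:
  assumes R: "\<forall>c\<in>edge_colourings {..<n}. has_mono n t c"
    and c: "c \<in> edge_colourings {..<Suc n}"
  shows "\<exists>c'. C3_switch_equiv {..<Suc n} c c' \<and> has_mono (Suc n) (Suc t) c'"
proof -
  let ?V = "{..<Suc n}"
  \<comment> \<open>Colour 1 is a placeholder: the colour of the clique \<open>H\<close> is known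
    only once the star is normalised.\<close>
  obtain c' where c': "C3_switch_equiv ?V c c'" "\<forall>u\<in>{..<n}. c' {u, n} = 1"
    using C3_switch_equiv_colour_star[OF c, of n "{..<n}" 1] by fastforce
  have sub: "[{..<n}]\<^bsup>2\<^esup> \<subseteq> [?V]\<^bsup>2\<^esup>"
    by (intro nsets_mono) auto
  have "restrict c' ([{..<n}]\<^bsup>2\<^esup>) \<in> edge_colourings {..<n}"
    using C3_switch_equiv_in_edge_colourings[OF c'(1) c] sub
    by (auto simp: edge_colourings_def)
  then obtain i H where i: "i \<in> {1..3}" and H: "H \<in> [{..<n}]\<^bsup>t\<^esup>"
    "restrict c' ([{..<n}]\<^bsup>2\<^esup>) ` [H]\<^bsup>2\<^esup> \<subseteq> {i}"
    using R unfolding has_mono_def monochromatic_def by blast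
  have Hn: "H \<subseteq> {..<n}" "finite H" "card H = t"
    using H(1) by (auto simp: nsets_def)
  obtain \<pi> where \<pi>: "\<pi> \<in> C3" "\<pi> 1 = i"
    using C3_transitive[of 1 i] i by auto
  let ?c = "switch ?V n \<pi> c'"
  have "?c e = i" if "e \<in> [insert n H]\<^bsup>2\<^esup>" for e
  proof (cases "n \<in> e")
    case True
    with that obtain u where "u \<in> H" "e = {u, n}"
      by (auto elim!: nsets2_E simp: insert_commute)
    then show ?thesis
      using Hn c'(2) \<pi>(2) by (auto simp: switch_def)
  next
    case False
    with that have "e \<in> [H]\<^bsup>2\<^esup>"
      by (auto simp: nsets_def)
    moreover from this have "e \<in> [{..<n}]\<^bsup>2\<^esup>"
      using nsets_mono[OF Hn(1)] by blast
    ultimately have "c' e = i"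
      using H(2) by (auto simp: image_subset_iff)
    with False show ?thesis
      by (simp add: switch_def)
  qed
  moreover have "insert n H \<in> [?V]\<^bsup>Suc t\<^esup>"
    using Hn by (auto simp: nsets_def card_insert_if)
  ultimately have "has_mono (Suc n) (Suc t) ?c"
    using i unfolding has_mono_def monochromatic_def by blast
  moreover have "C3_switch_equiv ?V c ?c"
    using c'(1) \<pi>(1) by (intro C3_switch_equiv.step) auto
  ultimately show ?thesis
    by blast
qed

section \<open>A circulant colouring on 17 vertices\<close>

text \<open>The table was found by a search among circulant colourings. These are the natural candidates:
  colouring the projective line over the field of 16 elements by \<open>0\<close> on edges at \<open>\<infinity>\<close> and by
  \<open>log (a - b) mod 3\<close> elsewhere also works, its switching class is invariant under \<open>PGL(2,16)\<close>,
  and this group contains an element permuting the 17 points cyclically. The entry at index 0 is a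
  dummy.\<close>

definition gap_colour :: "nat \<Rightarrow> nat" where
  "gap_colour d = [1, 1, 1, 2, 1, 2, 3, 3, 1, 1, 3, 3, 2, 1, 2, 1, 1] ! d"

lemma gap_colour_in: "d \<le> 16 \<Longrightarrow> gap_colour d \<in> {1..3}"
proof -
  have "\<forall>d\<in>set [0..<17]. gap_colour d \<in> {1..3}"
    by code_simp
  then show "d \<le> 16 \<Longrightarrow> gap_colour d \<in> {1..3}"
    by auto
qed

text \<open>For \<open>a < b < u < v\<close> with successive gaps \<open>x\<close>,
  \<open>y\<close>, \<open>z\<close>, the sums belong to the matchings \<open>ab|uv\<close>,
  \<open>au|bv\<close> and \<open>av|bu\<close>. All 560 gap triples are evaluated.\<close>

lemma gap_colour_unbalanced:
  assumes "0 < x" "0 < y" "0 < z" "x + y + z \<le> 16"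
  shows "\<not> ([gap_colour x + gap_colour z = gap_colour (x + y) + gap_colour (y + z)] (mod 3) \<and>
    [gap_colour x + gap_colour z = gap_colour (x + y + z) + gap_colour y] (mod 3))"
proof -
  have "\<forall>x\<in>set [1..<17]. \<forall>y\<in>set [1..<17 - x]. \<forall>z\<in>set [1..<17 - (x + y)].
    \<not> ((gap_colour x + gap_colour z) mod 3 = (gap_colour (x + y) + gap_colour (y + z)) mod 3 \<and>
      (gap_colour x + gap_colour z) mod 3 = (gap_colour (x + y + z) + gap_colour y) mod 3)"
    by code_simp
  moreover have "x \<in> set [1..<17]" "y \<in> set [1..<17 - x]" "z \<in> set [1..<17 - (x + y)]"
    using assms by auto
  ultimately show ?thesis
    unfolding cong_def by blast
qed

text \<open>The parameter \<open>n\<close> yields a counterexample for each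
  \<open>n \<le> 17\<close>, as minimality of 18 demands.\<close>

definition gap_colouring :: "nat \<Rightarrow> nat set \<Rightarrow> nat" where
  "gap_colouring n = restrict (\<lambda>e. gap_colour (Max e - Min e)) ([{..<n}]\<^bsup>2\<^esup>)"

lemma gap_colouring_doubleton:
  "a < b \<Longrightarrow> b < n \<Longrightarrow> gap_colouring n {a, b} = gap_colour (b - a)"
  by (simp add: gap_colouring_def)

lemma gap_colouring_in_edge_colourings:
  assumes "n \<le> 17"
  shows "gap_colouring n \<in> edge_colourings {..<n}"
proof -
  have "gap_colour (Max e - Min e) \<in> {1..3}" if "e \<in> [{..<n}]\<^bsup>2\<^esup>" for e
  proof -
    have "Max e \<in> e"
      using that by (intro Max_in) (auto simp: nsets_def)
    then have "Max e < n"
      using that by (auto simp: nsets_def)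
    with assms show ?thesis
      by (intro gap_colour_in) auto
  qed
  then show ?thesis
    by (auto simp: edge_colourings_def gap_colouring_def)
qed

lemma not_has_mono_gap_colouring:
  assumes n: "n \<le> 17" and equiv: "C3_switch_equiv {..<n} (gap_colouring n) c'"
  shows "\<not> has_mono n 4 c'"
proof
  assume "has_mono n 4 c'"
  then obtain i H where "H \<in> [{..<n}]\<^bsup>4\<^esup>" and mono: "c' ` [H]\<^bsup>2\<^esup> \<subseteq> {i}"
    unfolding has_mono_def monochromatic_def by blast
  then obtain a b u v where H: "H = {a, b, u, v}" and lt: "a < b" "b < u" "u < v" "v < n"
    by (auto simp: ordered_nsets_4_eq)
  let ?c = "gap_colouring n"
  have perm: "{a, b, v, u} = H"
    by (auto simp: H)
  have "[?c {a, b} + ?c {u, v} = ?c {a, u} + ?c {b, v}] (mod 3)"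
    by (rule mono_K4_balanced[OF equiv gap_colouring_in_edge_colourings[OF n]])
      (use lt mono in \<open>auto simp flip: H\<close>)
  \<comment> \<open>Exchanging \<open>u\<close> and \<open>v\<close> brings in the third
    matching.\<close>
  moreover have "[?c {a, b} + ?c {v, u} = ?c {a, v} + ?c {b, u}] (mod 3)"
    by (rule mono_K4_balanced[OF equiv gap_colouring_in_edge_colourings[OF n]])
      (use lt mono in \<open>auto simp: perm\<close>)
  moreover have "b - a + (u - b) = u - a" "u - b + (v - u) = v - b" "u - a + (v - u) = v - a" "v - a \<le> 16"
    using lt n by auto
  ultimately show False
    using gap_colour_unbalanced[of "b - a" "u - b" "v - u"] lt
    by (simp add: gap_colouring_doubleton insert_commute[of v u])
qed

theorem theorem26:
  shows "C3_ramsey_number 4 4 4 = ramsey_number 3 3 3 + 1 \<and> C3_ramsey_number 4 4 4 = 18"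
proof -
  define P where "P n \<longleftrightarrow> (\<forall>c\<in>edge_colourings {..<n}. has_mono n 3 c)" for n
  define Q where "Q n \<longleftrightarrow> (\<forall>c\<in>edge_colourings {..<n}.
    \<exists>c'. C3_switch_equiv {..<n} c c' \<and> has_mono n 4 c')" for n
  have PQ: "Q (Suc n)" if "P n" for n
    using that has_mono_switch_Suc[of n 3] by (simp add: P_def Q_def)
  have not_Q: "\<not> Q n" if "n \<le> 17" for n
    using that gap_colouring_in_edge_colourings not_has_mono_gap_colouring
    unfolding Q_def by blast
  have "P 17"
    by (simp add: P_def has_mono_triangle_17)
  have "(LEAST n. P n) = 17"
  proof (rule Least_equality)
    show "P 17"
      by fact
    \<comment> \<open>\<open>P n\<close> gives \<open>Q (Suc n)\<close>, so \<open>Suc n\<close>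
      exceeds 17; no separate triangle-free colouring is constructed.\<close>
    show "17 \<le> n" if "P n" for n
      using PQ[OF that] not_Q[of "Suc n"] by linarith
  qed
  moreover have "(LEAST n. Q n) = 18"
  proof (rule Least_equality)
    show "Q 18"
      using PQ[OF \<open>P 17\<close>] by simp
    show "18 \<le> n" if "Q n" for n
      using that not_Q[of n] by linarith
  qed
  ultimately show ?thesis
    unfolding P_def Q_def C3_ramsey_number_def ramsey_number_def has_mono_iff by simp
qed

end
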